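(* If a language $L\subseteq A^*$ is recognized by a semilinear equivariant deterministic finite automaton with the integer atoms, then the minimal deterministic automaton of $L$ is also a semilinear equivariant deterministic finite automaton.
   Context: Integer atoms: the atoms are the integers $\mathbb{Z}$ with the successor function; the automorphisms are exactly the translations $x\mapsto x+z$, acting hereditarily on sets built from atoms. A set, relation or function is equivariant if invariant under all translations; an equivariant set is orbit-finite if it is a finite union of orbits. For $k\ge1$, $\mathbb{Z}_k$ is the integers modulo $k$ with translations acting by addition, $\mathbb{Z}_0=\mathbb{Z}$; every equivariant single-orbit set is equivariantly isomorphic to some $\mathbb{Z}_k$. A monomial set is a finite product of equivariant single-orbit sets, a polynomial set a finite disjoint union of monomials. A subset of $\mathbb{Z}^m$ is semilinear if Presburger-definable; every subset of $\mathbb{Z}_k$ ($k\ge1$) is semilinear; subsets of general monomials and polynomial sets are semilinear if semilinear after transport along equivariant isomorphisms to disjoint unions of monomials $\mathbb{Z}^m$, $\mathbb{Z}_k$ (via $\mathbb{Z}_k\times\mathbb{Z}\cong k$ copies of $\mathbb{Z}$, $\mathbb{Z}_k\times\mathbb{Z}_l\cong\mathbb{Z}_{\mathrm{lcm}(k,l)}$), componentwise. A DFA with atoms consists of an orbit-finite equivariant alphabet $A$, an orbit-finite equivariant state set $Q$, a transition function $\delta:Q\times A\to Q$, an initial state and accepting states $F\subseteq Q$; it is equivariant if $\delta$, the initial state and $F$ are equivariant, and semilinear if $\delta$ is a semilinear subset of $Q\times A\times Q$. The minimal automaton of $L$ is the Myhill–Nerode (syntactic) automaton, whose states are the classes of words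 modulo the Myhill–Nerode equivalence of $L$. *)

theory Defs
  imports
    "HOL-Algebra.Group_Action"
    "HOL-Algebra.Elementary_Groups"
    "HOL-Combinatorics.Permutations"
begin

section \<open>Sets with integer atoms\<close>

text \<open>
  The only automorphism of the integer atoms that fixes an atom is the identity, so every object
  built from atoms is supported by any single atom. Finite support is therefore no restriction,
  and an equivariant set with integer atoms is a set with an action of the translation group.
\<close>

definition orbit_finite :: "'x set \<Rightarrow> (int \<Rightarrow> 'x \<Rightarrow> 'x) \<Rightarrow> bool" where
  "orbit_finite X act \<longleftrightarrow>
     group_action integer_group X act \<and> finite (orbits integer_group X act)"

definition equivariant_set :: "(int \<Rightarrow> 'x \<Rightarrow> 'x) \<Rightarrow> 'x set \<Rightarrow> bool" where
  "equivariant_set act S \<longleftrightarrow> (\<forall>z. act z ` S = S)"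

text \<open>
  Equivariant isomorphism with $Z_k$. The library group has carrier \<open>{0..<k}\<close> for \<open>k > 0\<close>
  and all integers for \<open>k = 0\<close>; in the latter case \<open>mod int k\<close> is the identity.
\<close>

definition orbit_iso :: "(int \<Rightarrow> 'x \<Rightarrow> 'x) \<Rightarrow> 'x set \<Rightarrow> nat \<Rightarrow> ('x \<Rightarrow> int) \<Rightarrow> bool" where
  "orbit_iso act X k f \<longleftrightarrow>
     bij_betw f X (carrier (integer_mod_group k)) \<and>
     (\<forall>x\<in>X. \<forall>z. f (act z x) = (f x + z) mod int k)"


section \<open>Presburger-definable sets of integer vectors\<close>

datatype presburger_term =
    Var nat
  | Const int
  | Plus presburger_term presburger_term

datatype presburger_formula =
    LessEq presburger_term presburger_term
  | Neg presburger_formula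
  | Conj presburger_formula presburger_formula
  | Exists nat presburger_formula

primrec term_val :: "(nat \<Rightarrow> int) \<Rightarrow> presburger_term \<Rightarrow> int" where
  "term_val e (Var i) = e i"
| "term_val e (Const c) = c"
| "term_val e (Plus s t) = term_val e s + term_val e t"

primrec holds :: "(nat \<Rightarrow> int) \<Rightarrow> presburger_formula \<Rightarrow> bool" where
  "holds e (LessEq s t) \<longleftrightarrow> term_val e s \<le> term_val e t"
| "holds e (Neg p) \<longleftrightarrow> \<not> holds e p"
| "holds e (Conj p q) \<longleftrightarrow> holds e p \<and> holds e q"
| "holds e (Exists i p) \<longleftrightarrow> (\<exists>x. holds (e(i := x)) p)"

definition presburger_definable :: "nat \<Rightarrow> int list set \<Rightarrow> bool" where
  "presburger_definable m S \<longleftrightarrow>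
     S \<subseteq> {xs. length xs = m} \<and>
     (\<exists>p. \<forall>e. holds e p \<longleftrightarrow> map e [0..<m] \<in> S)"


section \<open>Semilinear subsets of monomial and polynomial sets\<close>

text \<open>The monomial $Z_{k_1} \times \dots \times Z_{k_n}$, with tuples as lists.\<close>

definition monomial :: "nat list \<Rightarrow> int list set" where
  "monomial ks = listset (map (\<lambda>k. carrier (integer_mod_group k)) ks)"

text \<open>
  A subset of a monomial is transported to a disjoint union of monomials $Z^m$ and $Z_k$ along
  reorderings of the factors and the two equivariant isomorphisms below, in each of which the
  first component of a pair on the left is the index of a copy:

  \<^item> $\{0,\dots,k-1\} \times Z \to Z_k \times Z$, $(c, x) \mapsto (x + c, x)$;

  \<^item> $\{0,\dots,g-1\} \times Z_{lcm(k,l)} \to Z_k \times Z_l$, $(d, x) \mapsto (x, x + d)$,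
    where $g = gcd(k,l)$ (a single copy if \<open>k\<close> and \<open>l\<close> are coprime).
\<close>

inductive semilinear :: "nat list \<Rightarrow> int list set \<Rightarrow> bool" where
  presburger:
    "presburger_definable m S \<Longrightarrow> semilinear (replicate m 0) S"
| cyclic:
    "1 \<le> k \<Longrightarrow> S \<subseteq> monomial [k] \<Longrightarrow> semilinear [k] S"
| reorder:
    "S \<subseteq> monomial ks \<Longrightarrow> p permutes {..<length ks} \<Longrightarrow>
     semilinear (permute_list p ks) (permute_list p ` S) \<Longrightarrow> semilinear ks S"
| cyclic_times_Z:
    "1 \<le> k \<Longrightarrow> S \<subseteq> monomial (k # 0 # ks) \<Longrightarrow>
     (\<And>c. 0 \<le> c \<Longrightarrow> c < int k \<Longrightarrow>
        semilinear (0 # ks)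
          {x # xs | x xs. x # xs \<in> monomial (0 # ks) \<and> ((x + c) mod int k) # x # xs \<in> S}) \<Longrightarrow>
     semilinear (k # 0 # ks) S"
| cyclic_times_cyclic:
    "1 \<le> k \<Longrightarrow> 1 \<le> l \<Longrightarrow> S \<subseteq> monomial (k # l # ks) \<Longrightarrow>
     (\<And>d. 0 \<le> d \<Longrightarrow> d < int (gcd k l) \<Longrightarrow>
        semilinear (lcm k l # ks)
          {x # xs | x xs. x # xs \<in> monomial (lcm k l # ks) \<and>
             (x mod int k) # ((x + d) mod int l) # xs \<in> S}) \<Longrightarrow>
     semilinear (k # l # ks) S"

definition semilinear_monomial3 ::
  "(int \<Rightarrow> 'x \<Rightarrow> 'x) \<Rightarrow> 'x set \<Rightarrow> (int \<Rightarrow> 'y \<Rightarrow> 'y) \<Rightarrow> 'y set \<Rightarrow>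
   (int \<Rightarrow> 'z \<Rightarrow> 'z) \<Rightarrow> 'z set \<Rightarrow> ('x \<times> 'y \<times> 'z) set \<Rightarrow> bool" where
  "semilinear_monomial3 actX X actY Y actZ Z S \<longleftrightarrow>
     S \<subseteq> X \<times> Y \<times> Z \<and>
     (\<exists>k l m f g h. orbit_iso actX X k f \<and> orbit_iso actY Y l g \<and> orbit_iso actZ Z m h \<and>
        semilinear [k, l, m] ((\<lambda>(x, y, z). [f x, g y, h z]) ` S))"

text \<open>
  A product of three orbit-finite sets is the polynomial set whose monomials are the products of
  their orbits.
\<close>

definition semilinear_polynomial3 ::
  "(int \<Rightarrow> 'x \<Rightarrow> 'x) \<Rightarrow> 'x set \<Rightarrow> (int \<Rightarrow> 'y \<Rightarrow> 'y) \<Rightarrow> 'y set \<Rightarrow>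
   (int \<Rightarrow> 'z \<Rightarrow> 'z) \<Rightarrow> 'z set \<Rightarrow> ('x \<times> 'y \<times> 'z) set \<Rightarrow> bool" where
  "semilinear_polynomial3 actX X actY Y actZ Z S \<longleftrightarrow>
     S \<subseteq> X \<times> Y \<times> Z \<and>
     (\<forall>P\<in>orbits integer_group X actX. \<forall>Q\<in>orbits integer_group Y actY.
        \<forall>R\<in>orbits integer_group Z actZ.
          semilinear_monomial3 actX P actY Q actZ R (S \<inter> P \<times> Q \<times> R))"


section \<open>Deterministic automata with atoms\<close>

record ('a, 'q) automaton =
  alphabet :: "'a set"
  letter_act :: "int \<Rightarrow> 'a \<Rightarrow> 'a"
  states :: "'q set"
  state_act :: "int \<Rightarrow> 'q \<Rightarrow> 'q"
  trans :: "'q \<Rightarrow> 'a \<Rightarrow> 'q"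
  initial :: 'q
  accepting :: "'q set"

definition dfa :: "('a, 'q) automaton \<Rightarrow> bool" where
  "dfa M \<longleftrightarrow>
     orbit_finite (alphabet M) (letter_act M) \<and>
     orbit_finite (states M) (state_act M) \<and>
     (\<forall>q\<in>states M. \<forall>a\<in>alphabet M. trans M q a \<in> states M) \<and>
     initial M \<in> states M \<and>
     accepting M \<subseteq> states M"

definition equivariant_dfa :: "('a, 'q) automaton \<Rightarrow> bool" where
  "equivariant_dfa M \<longleftrightarrow>
     (\<forall>q\<in>states M. \<forall>a\<in>alphabet M. \<forall>z.
        trans M (state_act M z q) (letter_act M z a) = state_act M z (trans M q a)) \<and>
     (\<forall>z. state_act M z (initial M) = initial M) \<and>
     equivariant_set (state_act M) (accepting M)"

definition trans_graph :: "('a, 'q) automaton \<Rightarrow> ('q \<times> 'a \<times> 'q) set" where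
  "trans_graph M = {(q, a, trans M q a) | q a. q \<in> states M \<and> a \<in> alphabet M}"

definition semilinear_dfa :: "('a, 'q) automaton \<Rightarrow> bool" where
  "semilinear_dfa M \<longleftrightarrow>
     semilinear_polynomial3 (state_act M) (states M) (letter_act M) (alphabet M)
       (state_act M) (states M) (trans_graph M)"

definition language :: "('a, 'q) automaton \<Rightarrow> 'a list set" where
  "language M = {w \<in> lists (alphabet M). foldl (trans M) (initial M) w \<in> accepting M}"


section \<open>The minimal automaton\<close>

definition myhill_nerode :: "'a set \<Rightarrow> 'a list set \<Rightarrow> ('a list \<times> 'a list) set" where
  "myhill_nerode A L =
     {(u, v). u \<in> lists A \<and> v \<in> lists A \<and> (\<forall>w\<in>lists A. u @ w \<in> L \<longleftrightarrow> v @ w \<in> L)}"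

text \<open>
  Translations act on words letterwise and on classes of words elementwise; the restriction is
  needed because an action in the library is extensional on the set acted upon.
\<close>

definition minimal_automaton ::
  "'a set \<Rightarrow> (int \<Rightarrow> 'a \<Rightarrow> 'a) \<Rightarrow> 'a list set \<Rightarrow> ('a, 'a list set) automaton" where
  "minimal_automaton A act L =
     \<lparr>alphabet = A,
      letter_act = act,
      states = lists A // myhill_nerode A L,
      state_act = (\<lambda>z. \<lambda>C\<in>lists A // myhill_nerode A L. map (act z) ` C),
      trans = (\<lambda>C a. \<Union>w\<in>C. myhill_nerode A L `` {w @ [a]}),
      initial = myhill_nerode A L `` {[]},
      accepting = {myhill_nerode A L `` {w} | w. w \<in> L}\<rparr>"

end

theory Submission
  imports Defs
begin

text \<open>
  Encoding $Z_k$ as \<open>{0..<k}\<close>, the semilinear subsets of a monomial are exactly its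
  Presburger-definable subsets: the two transport isomorphisms are Presburger-definable, and they
  reduce every monomial to some $Z^m$ or $Z_k$. Hence semilinear sets are closed under finite unions
  and under images by coordinatewise maps \<open>x \<mapsto> (x + c) mod l\<close>, and every equivariant
  map between single orbits has this form in coordinates. Sending a reachable state to the class of
  the words leading to it is an equivariant surjection onto the minimal automaton, so the minimal
  automaton has finitely many orbits, and on each product of orbits its transition graph is a finite
  union of images of semilinear pieces of the given one.
\<close>


section \<open>Closure properties of Presburger-definable predicates\<close>

text \<open>Like \<open>definable\<close> below, a semantic notion on functions of the environment:
  definability of a HOL expression then follows from closure rules, without writing formulas
  down.\<close>

definition linear_term :: "((nat \<Rightarrow> int) \<Rightarrow> int) \<Rightarrow> bool" where
  "linear_term t \<longleftrightarrow> (\<exists>s. \<forall>e. term_val e s = t e)"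

definition definable :: "((nat \<Rightarrow> int) \<Rightarrow> bool) \<Rightarrow> bool" where
  "definable P \<longleftrightarrow> (\<exists>p. \<forall>e. holds e p \<longleftrightarrow> P e)"

lemma presburger_definable_iff:
  "presburger_definable m S \<longleftrightarrow>
     S \<subseteq> {xs. length xs = m} \<and> definable (\<lambda>e. map e [0..<m] \<in> S)"
  by (simp add: presburger_definable_def definable_def)

section \<open>Linear terms, Boolean combinations and quantifiers\<close>

lemma linear_term_term_val: "linear_term (\<lambda>e. term_val e s)"
  unfolding linear_term_def by blast

lemma linear_term_var [intro!, simp]: "linear_term (\<lambda>e. e i)"
  unfolding linear_term_def by (rule exI[of _ "Var i"]) simp

lemma linear_term_const [intro!, simp]: "linear_term (\<lambda>e. c)"
  unfolding linear_term_def by (rule exI[of _ "Const c"]) simp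

lemma linear_term_add [intro!, simp]:
  assumes "linear_term s" "linear_term t"
  shows "linear_term (\<lambda>e. s e + t e)"
  using assms unfolding linear_term_def by (metis term_val.simps(3))

text \<open>Terms offer only addition, so a constant factor is unfolded into repeated
  addition.\<close>

lemma linear_term_mult [intro!, simp]:
  assumes "linear_term t"
  shows "linear_term (\<lambda>e. int k * t e)"
proof (induction k)
  case (Suc k)
  have "linear_term (\<lambda>e. int k * t e + t e)"
    using Suc assms by (rule linear_term_add)
  then show ?case by (simp add: algebra_simps)
qed simp

lemma definable_le [intro!, simp]:
  assumes "linear_term s" "linear_term t"
  shows "definable (\<lambda>e. s e \<le> t e)"
  using assms unfolding linear_term_def definable_def by (metis holds.simps(1))

lemma definable_not [intro!, simp]:
  assumes "definable P"
  shows "definable (\<lambda>e. \<not> P e)"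
  using assms unfolding definable_def by (metis holds.simps(2))

lemma definable_conj [intro!, simp]:
  assumes "definable P" "definable Q"
  shows "definable (\<lambda>e. P e \<and> Q e)"
  using assms unfolding definable_def by (metis holds.simps(3))

lemma definable_disj [intro!, simp]:
  assumes "definable P" "definable Q"
  shows "definable (\<lambda>e. P e \<or> Q e)"
  using definable_not[OF definable_conj[OF definable_not[OF assms(1)] definable_not[OF assms(2)]]]
  by simp

lemma definable_eq [intro!, simp]:
  assumes "linear_term s" "linear_term t"
  shows "definable (\<lambda>e. s e = t e)"
proof -
  have "(\<lambda>e. s e = t e) = (\<lambda>e. s e \<le> t e \<and> t e \<le> s e)"
    by auto
  then show ?thesis
    using assms by simp
qed

lemma definable_bool [intro!, simp]: "definable (\<lambda>e. b)"
  by (cases b) (use definable_le[of "\<lambda>e. 0" "\<lambda>e. 0"] definable_le[of "\<lambda>e. 1" "\<lambda>e. 0"] in simp_all)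

lemma definable_less [intro!, simp]:
  assumes "linear_term s" "linear_term t"
  shows "definable (\<lambda>e. s e < t e)"
  using definable_not[OF definable_le[OF assms(2,1)]] by (simp add: not_le)

lemma definable_bex [intro]:
  assumes "finite I" "\<And>i. i \<in> I \<Longrightarrow> definable (P i)"
  shows "definable (\<lambda>e. \<exists>i\<in>I. P i e)"
  using assms by (induction I rule: finite_induct) auto

text \<open>\<open>Exists\<close> overwrites a numbered variable. A HOL quantifier is simulated by
  storing its witness in a variable \<open>j\<close> on which \<open>P x\<close> does not depend;
  the second assumption is this freshness.\<close>

lemma definable_ex:
  assumes "definable (\<lambda>e. P (e j) e)" and "\<And>x y e. P x (e(j := y)) = P x e"
  shows "definable (\<lambda>e. \<exists>x. P x e)"
proof -
  obtain p where "\<And>e. holds e p \<longleftrightarrow> P (e j) e"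
    using assms(1) unfolding definable_def by blast
  then have "holds e (Exists j p) \<longleftrightarrow> (\<exists>x. P x e)" for e
    by (simp add: assms(2))
  then show ?thesis
    unfolding definable_def by blast
qed

section \<open>Finite support and substitution\<close>

lemma linear_term_finite_support:
  assumes "linear_term t"
  shows "\<exists>N. \<forall>e e'. (\<forall>i<N. e i = e' i) \<longrightarrow> t e = t e'"
proof -
  have "\<exists>N. \<forall>e e'. (\<forall>i<N. e i = e' i) \<longrightarrow> term_val e s = term_val e' s" for s
  proof (induction s)
    case (Var i)
    show ?case by (rule exI[of _ "Suc i"]) simp
  next
    case (Plus s1 s2)
    then obtain N1 N2
      where "\<forall>e e'. (\<forall>i<N1. e i = e' i) \<longrightarrow> term_val e s1 = term_val e' s1"
        and "\<forall>e e'. (\<forall>i<N2. e i = e' i) \<longrightarrow> term_val e s2 = term_val e' s2"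
      by blast
    then show ?case
      by (intro exI[of _ "max N1 N2"]) (simp add: max_def, smt (verit) order_less_le_trans nle_le)
  qed simp
  then show ?thesis
    using assms unfolding linear_term_def by metis
qed

text \<open>Only finitely many variables occur in a formula. The bound serves to pick a fresh
  variable in \<open>definable_subst\<close>.\<close>

lemma holds_finite_support:
  "\<exists>N. \<forall>e e'. (\<forall>i<N. e i = e' i) \<longrightarrow> holds e p = holds e' p"
proof (induction p)
  case (LessEq s t)
  obtain N1 N2
    where "\<forall>e e'. (\<forall>i<N1. e i = e' i) \<longrightarrow> term_val e s = term_val e' s"
      and "\<forall>e e'. (\<forall>i<N2. e i = e' i) \<longrightarrow> term_val e t = term_val e' t"
    using linear_term_finite_support[of "\<lambda>e. term_val e s"]
      linear_term_finite_support[of "\<lambda>e. term_val e t"] linear_term_term_val by blast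
  then have "\<forall>e e'. (\<forall>i<max N1 N2. e i = e' i) \<longrightarrow>
      term_val e s = term_val e' s \<and> term_val e t = term_val e' t"
    by (metis less_max_iff_disj)
  then show ?case
    by (intro exI[of _ "max N1 N2"]) (metis holds.simps(1))
next
  case (Conj p q)
  then obtain N1 N2
    where "\<forall>e e'. (\<forall>i<N1. e i = e' i) \<longrightarrow> holds e p = holds e' p"
      and "\<forall>e e'. (\<forall>i<N2. e i = e' i) \<longrightarrow> holds e q = holds e' q"
    by blast
  then have "\<forall>e e'. (\<forall>i<max N1 N2. e i = e' i) \<longrightarrow>
      holds e p = holds e' p \<and> holds e q = holds e' q"
    by (metis less_max_iff_disj)
  then show ?case
    by (intro exI[of _ "max N1 N2"]) (metis holds.simps(3))
next
  case (Exists j p)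
  then obtain N where N: "\<And>e e'. (\<forall>i<N. e i = e' i) \<Longrightarrow> holds e p = holds e' p"
    by blast
  have "holds (e(j := x)) p = holds (e'(j := x)) p" if "\<forall>i<N. e i = e' i" for e e' x
    by (rule N) (use that in simp)
  then show ?case
    unfolding holds.simps by (intro exI[of _ N] allI impI iff_exI) blast
qed simp

text \<open>Capture-avoiding substitution of linear terms for variables. The induction generalizes
  over \<open>\<sigma>\<close> because a quantifier forces its bound variable to be renamed.\<close>

lemma definable_subst:
  assumes "definable P" and "\<And>i. linear_term (\<sigma> i)"
  shows "definable (\<lambda>e. P (\<lambda>i. \<sigma> i e))"
proof -
  have "definable (\<lambda>e. holds (\<lambda>i. \<sigma> i e) p)" for p
    using assms(2)
  proof (induction p arbitrary: \<sigma>)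
    case (LessEq s t)
    have "linear_term (\<lambda>e. term_val (\<lambda>i. \<sigma> i e) s)" for s
      by (induction s) (auto simp: LessEq)
    then show ?case
      by simp
  next
    case (Exists j p)
    obtain N where N: "\<And>e e'. (\<forall>i<N. e i = e' i) \<Longrightarrow> holds e p = holds e' p"
      using holds_finite_support by blast
    obtain B where B: "\<And>i e e'. (\<forall>i'<B i. e i' = e' i') \<Longrightarrow> \<sigma> i e = \<sigma> i e'"
      using linear_term_finite_support[OF Exists.prems] by metis
    \<comment> \<open>Only variables below \<open>N\<close> matter to \<open>p\<close>, and
      \<open>\<sigma> i\<close> reads only variables below \<open>B i\<close>; hence variable
      \<open>k\<close> is fresh for every relevant \<open>\<sigma> i\<close>.\<close>
    define k where "k = (\<Sum>i<N. B i)"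
    have B_le: "B i \<le> k" if "i < N" for i
      unfolding k_def using that by (intro member_le_sum) auto
    have fresh: "\<sigma> i (e(k := x)) = \<sigma> i e" if "i < N" for i e x
      by (rule B) (use B_le[OF that] in auto)
    show ?case
      unfolding holds.simps
    proof (rule definable_ex[where j = k])
      \<comment> \<open>The bound variable \<open>j\<close> is renamed to \<open>k\<close>.\<close>
      have "definable (\<lambda>e. holds (\<lambda>i. (\<sigma>(j := \<lambda>e. e k)) i e) p)"
        by (rule Exists.IH) (simp add: Exists.prems)
      moreover have "(\<lambda>i. (\<sigma>(j := \<lambda>e. e k)) i e) = (\<lambda>i. \<sigma> i e)(j := e k)" for e
        by auto
      ultimately show "definable (\<lambda>e. holds ((\<lambda>i. \<sigma> i e)(j := e k)) p)"
        by simp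
    qed (rule N, simp add: fresh)
  qed auto
  moreover obtain p where "P = (\<lambda>e. holds e p)"
    using assms(1) unfolding definable_def by blast
  ultimately show ?thesis
    by simp
qed

text \<open>Division with remainder turns the equation into an existential statement about the
  quotient; for \<open>k = 0\<close> it is plain equality, as reduction modulo 0 is the
  identity.\<close>

lemma definable_eq_mod [intro!, simp]:
  assumes "linear_term s" "linear_term t"
  shows "definable (\<lambda>e. s e = t e mod int k)"
proof -
  have eq_mod: "x = y mod int k \<longleftrightarrow>
      (if k = 0 then x = y else 0 \<le> x \<and> x < int k \<and> (\<exists>q. y = int k * q + x))" for x y :: int
    by (auto intro: exI[of _ "y div int k"])
  \<comment> \<open>Variables 0 and 1 stand for the two terms, which leaves variable 2 free for the
    quotient; \<open>s\<close> and \<open>t\<close> are substituted only afterwards.\<close>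
  have "definable (\<lambda>e. \<exists>q. e 1 = int k * q + e 0)"
    by (rule definable_ex[where j = 2]) auto
  then have "definable (\<lambda>e. e 0 = e 1 mod int k)"
    unfolding eq_mod by (cases "k = 0") auto
  then have "definable (\<lambda>e. (if (0::nat) = 0 then s else t) e = (if (1::nat) = 0 then s else t) e mod int k)"
    by (rule definable_subst[where \<sigma> = "\<lambda>i. if i = 0 then s else t"]) (use assms in simp)
  then show ?thesis
    by simp
qed

section \<open>Definable sets of integer tuples\<close>

lemma definable_mem:
  assumes "presburger_definable n S" and "\<And>i. linear_term (\<sigma> i)"
  shows "definable (\<lambda>e. map (\<lambda>i. \<sigma> i e) [0..<n] \<in> S)"
  using assms definable_subst unfolding presburger_definable_iff by blast

lemma map_upt_fun_upd_fresh:
  assumes "\<And>i. i < n \<Longrightarrow> h i \<noteq> j"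
  shows "map (\<lambda>i. (e(j := y)) (h i)) [0..<n] = map (\<lambda>i. e (h i)) [0..<n]"
  using assms by simp

text \<open>A tuple lies in the image exactly when its rearrangement by the inverse permutation lies
  in \<open>S\<close>, so this is a renaming of variables.\<close>

lemma presburger_definable_permute_list:
  assumes "presburger_definable n S" "p permutes {..<n}"
  shows "presburger_definable n (permute_list p ` S)"
proof -
  define q where "q = inv_into UNIV p"
  have q: "q permutes {..<n}" and pq: "p \<circ> q = id" and qp: "q \<circ> p = id"
    unfolding q_def using assms(2) by (auto simp: permutes_inv permutes_inv_o)
  have "definable (\<lambda>e. map (\<lambda>i. e (q i)) [0..<n] \<in> S)"
    using assms(1) by (rule definable_mem) simp
  moreover have "map e [0..<n] \<in> permute_list p ` S \<longleftrightarrow> map (\<lambda>i. e (q i)) [0..<n] \<in> S" for e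
  proof -
    have perm: "map (\<lambda>i. e (q i)) [0..<n] = permute_list q (map e [0..<n])"
      using permutes_in_image[OF q] by (auto simp: permute_list_def)
    have "permute_list q (permute_list p xs) = xs" "permute_list p (permute_list q xs) = xs"
      if "length xs = n" for xs :: "int list"
      using permute_list_compose[of p xs q] permute_list_compose[of q xs p] that q assms(2)
      by (simp_all add: pq qp permute_list_compose[symmetric])
    moreover have "length xs = n" if "xs \<in> S" for xs
      using assms(1) that by (auto simp: presburger_definable_iff)
    ultimately show ?thesis
      unfolding perm by (auto simp: image_iff) (metis diff_zero length_map length_upt)
  qed
  ultimately show ?thesis
    using assms(1) by (auto simp: presburger_definable_iff)
qed

lemma presburger_definable_UN:
  assumes "finite I" "\<And>i. i \<in> I \<Longrightarrow> presburger_definable n (S i)"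
  shows "presburger_definable n (\<Union>i\<in>I. S i)"
  using assms unfolding presburger_definable_iff by auto


section \<open>Semilinear subsets of monomials are the Presburger-definable ones\<close>

lemma mem_monomial_iff:
  "xs \<in> monomial ks \<longleftrightarrow> list_all2 (\<lambda>x k. x \<in> carrier (integer_mod_group k)) xs ks"
  unfolding monomial_def
  by (induction ks arbitrary: xs) (auto simp: set_Cons_def list_all2_Cons2)

lemma Cons_mem_monomial [simp]:
  "x # xs \<in> monomial (k # ks) \<longleftrightarrow> x \<in> carrier (integer_mod_group k) \<and> xs \<in> monomial ks"
  by (simp add: mem_monomial_iff)

lemma Nil_mem_monomial [simp]: "[] \<in> monomial ks \<longleftrightarrow> ks = []"
  by (simp add: mem_monomial_iff)

lemma length_monomial: "xs \<in> monomial ks \<Longrightarrow> length xs = length ks"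
  by (simp add: mem_monomial_iff list_all2_lengthD)

lemma monomial_replicate_0: "monomial (replicate m 0) = {xs. length xs = m}"
  by (auto simp: mem_monomial_iff list_all2_conv_all_nth carrier_integer_mod_group)

lemma mod_mem_carrier [simp]: "x mod int k \<in> carrier (integer_mod_group k)"
  by (simp add: carrier_integer_mod_group)

lemma mod_carrier: "x \<in> carrier (integer_mod_group k) \<Longrightarrow> x mod int k = x"
  by (auto simp: carrier_integer_mod_group split: if_splits)

text \<open>\<open>d\<close> is forced to be the residue of \<open>y - x\<close> modulo the gcd, after which Bezout applies.\<close>

lemma cyclic_times_cyclic_surj:
  fixes x y :: int and k l :: nat
  assumes "1 \<le> k" "1 \<le> l" "x \<in> carrier (integer_mod_group k)" "y \<in> carrier (integer_mod_group l)"
  obtains d u where "0 \<le> d" "d < int (gcd k l)" "u \<in> carrier (integer_mod_group (lcm k l))"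
    "u mod int k = x" "(u + d) mod int l = y"
proof -
  define g where "g = gcd (int k) (int l)"
  have g: "g = int (gcd k l)" "g > 0"
    using assms(1) by (simp_all add: g_def)
  obtain a b where ab: "a * int k + b * int l = g"
    using bezout_int unfolding g_def by blast
  define d where "d = (y - x) mod g"
  define q where "q = (y - x) div g"
  have yx: "y - x = q * g + d"
    by (simp add: d_def q_def)
  \<comment> \<open>The summand \<open>q * a * int k\<close> keeps the residue modulo
    \<open>k\<close>, while Bezout makes \<open>v + d\<close> differ from \<open>y\<close> by a
    multiple of \<open>l\<close>.\<close>
  define v where "v = x + q * a * int k"
  have v2: "v + d = y + int l * (- q * b)"
  proof -
    have "y = x + d + q * (a * int k + b * int l)"
      using yx by (simp add: ab)
    then show ?thesis
      by (simp add: v_def algebra_simps)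
  qed
  \<comment> \<open>Both \<open>k\<close> and \<open>l\<close> divide the lcm, so this reduction
    preserves both residues.\<close>
  define u where "u = v mod int (lcm k l)"
  have "u mod int k = v mod int k" "(u + d) mod int l = (v + d) mod int l"
  proof -
    show "u mod int k = v mod int k"
      unfolding u_def by (rule mod_mod_cancel) simp
    have "u mod int l = v mod int l"
      unfolding u_def by (rule mod_mod_cancel) simp
    then show "(u + d) mod int l = (v + d) mod int l"
      by (rule mod_add_cong) simp
  qed
  moreover have "v mod int k = x"
    using mod_carrier[OF assms(3)] by (simp add: v_def)
  moreover have "(v + d) mod int l = y"
    using mod_carrier[OF assms(4)] unfolding v2 by (metis mod_mult_self2)
  ultimately show ?thesis
    using g by (intro that[of d u]) (simp_all add: d_def u_def)
qed

text \<open>Each transport rule is undone by a definable map: \<open>S\<close> is the finite union,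
  over the copies, of the images of the transported pieces, which are definable by
  induction.\<close>

lemma semilinear_imp_presburger_definable:
  assumes "semilinear ks S"
  shows "S \<subseteq> monomial ks \<and> presburger_definable (length ks) S"
  using assms
proof (induction rule: semilinear.induct)
  case (presburger m S)
  then show ?case
    by (auto simp: monomial_replicate_0 presburger_definable_iff)
next
  case (cyclic k S)
  \<comment> \<open>A subset of a finite cyclic factor is finite, hence defined by a finite
    disjunction.\<close>
  have S: "S \<subseteq> (\<lambda>x. [x]) ` {0..<int k}"
  proof
    fix xs assume "xs \<in> S"
    then have "xs \<in> monomial [k]"
      using cyclic by blast
    then show "xs \<in> (\<lambda>x. [x]) ` {0..<int k}"
      using cyclic(1) by (auto simp: carrier_integer_mod_group mem_monomial_iff list_all2_Cons2)
  qed
  then have "finite S"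
    by (rule finite_subset) simp
  then have "definable (\<lambda>e. \<exists>xs\<in>S. e 0 = hd xs)"
    by auto
  moreover have "map e [0..<1] \<in> S \<longleftrightarrow> (\<exists>xs\<in>S. e 0 = hd xs)" for e
    using S by force
  ultimately show ?case
    using cyclic S by (auto simp: presburger_definable_iff)
next
  case (reorder S ks p)
  let ?q = "inv_into UNIV p"
  have "presburger_definable (length ks) (permute_list ?q ` permute_list p ` S)"
    using reorder.IH permutes_inv[OF reorder.hyps(2)]
    by (intro presburger_definable_permute_list[of _ "permute_list p ` S"]) auto
  moreover have "permute_list ?q (permute_list p xs) = xs" if "xs \<in> S" for xs
    using that reorder.hyps length_monomial permutes_inv[OF reorder.hyps(2)]
    by (subst permute_list_compose[symmetric]) (auto simp: permutes_inv_o)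
  ultimately show ?case
    using reorder.hyps(1) by (simp add: image_image cong: image_cong)
next
  case (cyclic_times_Z k S ks)
  let ?n = "length ks"
  let ?S = "\<lambda>c. {x # xs | x xs. x # xs \<in> monomial (0 # ks) \<and> ((x + c) mod int k) # x # xs \<in> S}"
  have "definable (\<lambda>e. map (\<lambda>i. e (Suc i)) [0..<Suc ?n] \<in> ?S c)" if "c \<in> {0..<int k}" for c
    using cyclic_times_Z.IH[of c] that by (intro definable_mem) auto
  then have "definable (\<lambda>e. \<exists>c\<in>{0..<int k}.
      e 0 = (e 1 + c) mod int k \<and> map (\<lambda>i. e (Suc i)) [0..<Suc ?n] \<in> ?S c)"
    by auto
  moreover have "map e [0..<Suc (Suc ?n)] \<in> S \<longleftrightarrow>
      (\<exists>c\<in>{0..<int k}. e 0 = (e 1 + c) mod int k \<and> map (\<lambda>i. e (Suc i)) [0..<Suc ?n] \<in> ?S c)"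
    for e
  proof -
    have "\<exists>c\<in>{0..<int k}. e 0 = (e 1 + c) mod int k" if "map e [0..<Suc (Suc ?n)] \<in> S"
    proof -
      have "e 0 \<in> carrier (integer_mod_group k)"
        using that cyclic_times_Z.hyps(2) by (auto simp: map_upt_Suc simp del: upt_Suc)
      \<comment> \<open>The copy containing a tuple is found as the residue of the difference of its
        first two coordinates.\<close>
      then have "e 0 = (e 1 + (e 0 - e 1) mod int k) mod int k"
        by (simp add: mod_simps mod_carrier)
      then show ?thesis
        using cyclic_times_Z.hyps(1) by (intro bexI[of _ "(e 0 - e 1) mod int k"]) auto
    qed
    then show ?thesis
      using cyclic_times_Z.hyps(2) by (force simp: map_upt_Suc simp del: upt_Suc)
  qed
  ultimately show ?case
    using cyclic_times_Z.hyps(2) by (auto simp: presburger_definable_iff length_monomial simp del: upt_Suc)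
next
  case (cyclic_times_cyclic k l S ks)
  let ?n = "length ks" and ?g = "int (gcd k l)"
  let ?S = "\<lambda>d. {x # xs | x xs. x # xs \<in> monomial (lcm k l # ks) \<and>
             (x mod int k) # ((x + d) mod int l) # xs \<in> S}"
  have "definable (\<lambda>e. \<exists>u. e 0 = u mod int k \<and> e 1 = (u + d) mod int l \<and>
      u # map (\<lambda>i. e (Suc (Suc i))) [0..<?n] \<in> ?S d)" if "d \<in> {0..<?g}" for d
  \<comment> \<open>The coordinates occupy the variables up to \<open>Suc ?n\<close>, so the next
    one is free for the point \<open>u\<close> of the merged factor.\<close>
  proof (rule definable_ex[where j = "Suc (Suc ?n)"])
    have "definable (\<lambda>e. map (\<lambda>i. (case i of 0 \<Rightarrow> \<lambda>e. e (Suc (Suc ?n)) | Suc i \<Rightarrow> \<lambda>e. e (Suc (Suc i))) e)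
        [0..<Suc ?n] \<in> ?S d)"
      using cyclic_times_cyclic.IH[of d] that by (intro definable_mem) (auto split: nat.split)
    then have "definable (\<lambda>e. e (Suc (Suc ?n)) # map (\<lambda>i. e (Suc (Suc i))) [0..<?n] \<in> ?S d)"
      by (simp add: map_upt_Suc del: upt_Suc)
    then show "definable (\<lambda>e. e 0 = e (Suc (Suc ?n)) mod int k \<and> e 1 = (e (Suc (Suc ?n)) + d) mod int l \<and>
      e (Suc (Suc ?n)) # map (\<lambda>i. e (Suc (Suc i))) [0..<?n] \<in> ?S d)"
      by (intro definable_conj definable_eq_mod) auto
  qed (simp_all add: map_upt_fun_upd_fresh fun_upd_other del: fun_upd_apply)
  then have "definable (\<lambda>e. \<exists>d\<in>{0..<?g}. \<exists>u. e 0 = u mod int k \<and> e 1 = (u + d) mod int l \<and>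
      u # map (\<lambda>i. e (Suc (Suc i))) [0..<?n] \<in> ?S d)"
    by (intro definable_bex) auto
  moreover have "map e [0..<Suc (Suc ?n)] \<in> S \<longleftrightarrow> (\<exists>d\<in>{0..<?g}. \<exists>u. e 0 = u mod int k \<and>
      e 1 = (u + d) mod int l \<and> u # map (\<lambda>i. e (Suc (Suc i))) [0..<?n] \<in> ?S d)" (is "_ \<longleftrightarrow> ?R e") for e
  proof
    assume S: "map e [0..<Suc (Suc ?n)] \<in> S"
    then have mem: "e 0 \<in> carrier (integer_mod_group k)" "e 1 \<in> carrier (integer_mod_group l)"
      "map (\<lambda>i. e (Suc (Suc i))) [0..<?n] \<in> monomial ks"
      using cyclic_times_cyclic.hyps(3) by (auto simp: map_upt_Suc simp del: upt_Suc)
    obtain d u where du: "0 \<le> d" "d < ?g" "u \<in> carrier (integer_mod_group (lcm k l))"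
        "u mod int k = e 0" "(u + d) mod int l = e 1"
      using cyclic_times_cyclic_surj[OF cyclic_times_cyclic.hyps(1,2) mem(1,2)] .
    show "?R e"
      using S du mem(3) by (intro bexI[of _ d] exI[of _ u]) (auto simp: map_upt_Suc simp del: upt_Suc)
  next
    assume "?R e"
    then show "map e [0..<Suc (Suc ?n)] \<in> S"
      by (auto simp: map_upt_Suc simp del: upt_Suc)
  qed
  ultimately show ?case
    using cyclic_times_cyclic.hyps(3)
    by (auto simp: presburger_definable_iff length_monomial simp del: upt_Suc)
qed

text \<open>Induction on the number of cyclic factors. With these in front, the first two merge into
  one modulo their lcm; a single one is absorbed into the neighbouring integer factor or, if there
  is none, is covered by \<open>cyclic\<close>.\<close>

lemma semilinear_cyclic_replicate:
  assumes "\<forall>k\<in>set ks. 1 \<le> k"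
    and "S \<subseteq> monomial (ks @ replicate m 0)" "presburger_definable (length ks + m) S"
  shows "semilinear (ks @ replicate m 0) S"
  using assms
proof (induction "length ks" arbitrary: ks S)
  case 0
  then show ?case
    by (simp add: semilinear.presburger)
next
  case (Suc r)
  then obtain k ks' where ks: "ks = k # ks'" "length ks' = r" "1 \<le> k"
    by (cases ks) auto
  show ?case
  proof (cases ks')
    case (Cons l ls)
    let ?n = "length ls + m"
    have l: "1 \<le> l"
      using Suc.prems ks Cons by simp
    have "semilinear (lcm k l # ls @ replicate m 0)
          {x # xs | x xs. x # xs \<in> monomial (lcm k l # ls @ replicate m 0) \<and>
             (x mod int k) # ((x + d) mod int l) # xs \<in> S}"  (is "semilinear _ ?S") for d
    proof -
      have "definable (\<lambda>e. \<exists>y. y = e 0 mod int k \<and> (\<exists>y'. y' = (e 0 + d) mod int l \<and>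
          y # y' # map (\<lambda>i. e (Suc i)) [0..<?n] \<in> S))"
      \<comment> \<open>The variables up to \<open>?n\<close> hold the transported tuple; the next
        two are free for the residues modulo \<open>k\<close> and \<open>l\<close>.\<close>
      proof (rule definable_ex[where j = "Suc ?n"], rule definable_conj)
        show "definable (\<lambda>e. \<exists>y'. y' = (e 0 + d) mod int l \<and>
          e (Suc ?n) # y' # map (\<lambda>i. e (Suc i)) [0..<?n] \<in> S)"
        proof (rule definable_ex[where j = "Suc (Suc ?n)"], rule definable_conj)
          have "definable (\<lambda>e. map (\<lambda>i. (case i of 0 \<Rightarrow> \<lambda>e. e (Suc ?n)
              | Suc i \<Rightarrow> (case i of 0 \<Rightarrow> \<lambda>e. e (Suc (Suc ?n)) | Suc i \<Rightarrow> \<lambda>e. e (Suc i))) e)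
              [0..<Suc (Suc ?n)] \<in> S)"
            using Suc.prems(3) ks Cons by (intro definable_mem) (auto split: nat.split)
          then show "definable (\<lambda>e. e (Suc ?n) # e (Suc (Suc ?n)) # map (\<lambda>i. e (Suc i)) [0..<?n] \<in> S)"
            by (simp add: map_upt_Suc del: upt_Suc)
        qed (simp_all add: map_upt_fun_upd_fresh fun_upd_other del: fun_upd_apply)
      qed (simp_all add: map_upt_fun_upd_fresh fun_upd_other del: fun_upd_apply)
      \<comment> \<open>The merged factor has a positive modulus, so its carrier is a finite
        interval; the ranges of the other coordinates are inherited from \<open>S\<close>.\<close>
      then have "definable (\<lambda>e. \<exists>c\<in>{0..<int (lcm k l)}. e 0 = c \<and>
           (\<exists>y. y = e 0 mod int k \<and> (\<exists>y'. y' = (e 0 + d) mod int l \<and>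
             y # y' # map (\<lambda>i. e (Suc i)) [0..<?n] \<in> S)))"
        by (intro definable_bex definable_conj) auto
      moreover have "map e [0..<Suc ?n] \<in> ?S \<longleftrightarrow> (\<exists>c\<in>{0..<int (lcm k l)}. e 0 = c \<and>
           (\<exists>y. y = e 0 mod int k \<and> (\<exists>y'. y' = (e 0 + d) mod int l \<and>
             y # y' # map (\<lambda>i. e (Suc i)) [0..<?n] \<in> S)))" for e
        using Suc.prems(2) ks Cons l
        by (auto simp: map_upt_Suc carrier_integer_mod_group lcm_eq_0_iff simp del: upt_Suc)
      ultimately have "presburger_definable (Suc ?n) ?S"
        by (auto simp: presburger_definable_iff length_monomial simp del: upt_Suc)
      moreover have "?S \<subseteq> monomial (lcm k l # ls @ replicate m 0)"
        by auto
      moreover have "\<forall>k\<in>set (lcm k l # ls). 1 \<le> k"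
        using ks Cons l Suc.prems(1) by (auto simp: Suc_le_eq lcm_pos_nat)
      ultimately show ?thesis
        using Suc.hyps(1)[of "lcm k l # ls" ?S] ks Cons by simp
    qed
    then show ?thesis
      using semilinear.cyclic_times_cyclic[OF ks(3) l, of S "ls @ replicate m 0"] Suc.prems ks Cons
      by simp
  next
    case Nil
    show ?thesis
    proof (cases m)
      case 0
      then show ?thesis
        using Suc.prems ks Nil by (auto intro: semilinear.cyclic)
    next
      case m: (Suc n)
      have "semilinear (0 # replicate n 0)
          {x # xs | x xs. x # xs \<in> monomial (0 # replicate n 0) \<and> ((x + c) mod int k) # x # xs \<in> S}"
        (is "semilinear _ ?S") for c
      proof -
        have "definable (\<lambda>e. \<exists>y. y = (e 0 + c) mod int k \<and> y # map e [0..<Suc n] \<in> S)"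
        proof (rule definable_ex[where j = "Suc n"], rule definable_conj)
          have "definable (\<lambda>e. map (\<lambda>i. (case i of 0 \<Rightarrow> \<lambda>e. e (Suc n) | Suc i \<Rightarrow> \<lambda>e. e i) e)
              [0..<Suc (Suc n)] \<in> S)"
            using Suc.prems(3) ks Nil m by (intro definable_mem) (auto split: nat.split)
          then show "definable (\<lambda>e. e (Suc n) # map e [0..<Suc n] \<in> S)"
            by (simp add: map_upt_Suc[of _ "Suc n"] del: upt_Suc)
        qed (simp_all add: map_upt_fun_upd_fresh fun_upd_other del: fun_upd_apply)
        moreover have "map e [0..<Suc n] \<in> ?S \<longleftrightarrow>
            (\<exists>y. y = (e 0 + c) mod int k \<and> y # map e [0..<Suc n] \<in> S)" for e
          using Suc.prems(2) ks Nil m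
          by (auto simp: map_upt_Suc simp del: upt_Suc)
        ultimately have "presburger_definable (Suc n) ?S"
          by (auto simp: presburger_definable_iff length_monomial simp del: upt_Suc)
        then show ?thesis
          using semilinear.presburger by fastforce
      qed
      then show ?thesis
        using semilinear.cyclic_times_Z[OF ks(3), of S "replicate n 0"] Suc.prems ks Nil m by simp
    qed
  qed
qed

text \<open>Replaces the inductive definition by a criterion with good closure properties. For the
  converse, a permutation moves the cyclic factors to the front, as
  \<open>semilinear_cyclic_replicate\<close> demands.\<close>

lemma semilinear_iff_presburger_definable:
  "semilinear ks S \<longleftrightarrow> S \<subseteq> monomial ks \<and> presburger_definable (length ks) S"
proof
  assume S: "S \<subseteq> monomial ks \<and> presburger_definable (length ks) S"
  define cs where "cs = filter (\<lambda>k. k \<noteq> 0) ks"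
  define m where "m = length (filter (\<lambda>k. k = 0) ks)"
  have "replicate m 0 = filter (\<lambda>k. k = 0) ks"
    unfolding m_def by (simp add: replicate_length_same)
  then have "mset (cs @ replicate m 0) = mset ks"
    by (simp add: cs_def add.commute multiset_partition[symmetric])
  then obtain p where p: "p permutes {..<length ks}" "permute_list p ks = cs @ replicate m 0"
    using mset_eq_permutation by metis
  have len: "length cs + m = length ks"
    by (metis p(2) length_append length_permute_list length_replicate)
  have sub: "permute_list p ` S \<subseteq> monomial (cs @ replicate m 0)"
    using S p(1) unfolding p(2)[symmetric]
    by (auto simp: mem_monomial_iff list_all2_permute_list_iff list_all2_lengthD dest!: subsetD)
  have "presburger_definable (length cs + m) (permute_list p ` S)"
    using S p(1) unfolding len by (blast intro: presburger_definable_permute_list)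
  then have "semilinear (cs @ replicate m 0) (permute_list p ` S)"
    using sub by (intro semilinear_cyclic_replicate) (auto simp: cs_def)
  then show "semilinear ks S"
    using S p by (intro semilinear.reorder[of S ks p]) auto
qed (use semilinear_imp_presburger_definable in blast)

text \<open>The image is a projection: variables 0 to 2 hold the image, 3 to 5 the quantified
  preimage. Equivariant maps between orbits take this form in coordinates, and a transition has
  three components.\<close>

lemma presburger_definable_image_mod3:
  assumes "presburger_definable 3 S"
  shows "presburger_definable 3
    {[(x + a) mod int k, (y + b) mod int l, (z + c) mod int m] | x y z. [x, y, z] \<in> S}"
    (is "presburger_definable 3 ?T")
proof -
  have upt3: "[0..<3] = [0, 1, 2::nat]"
    by (simp add: upt_rec)
  have "definable (\<lambda>e. map (\<lambda>i. e (3 + i)) [0..<3] \<in> S)"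
    using assms by (rule definable_mem) simp
  then have "definable (\<lambda>e. [e 3, e 4, e 5] \<in> S)"
    by (simp add: upt3)
  then have "definable (\<lambda>e. \<exists>z. e 2 = (z + c) mod int m \<and> [e 3, e 4, z] \<in> S)"
    by (intro definable_ex[where j = 5]) simp_all
  then have "definable (\<lambda>e. \<exists>y. e 1 = (y + b) mod int l \<and>
      (\<exists>z. e 2 = (z + c) mod int m \<and> [e 3, y, z] \<in> S))"
    by (intro definable_ex[where j = 4]) simp_all
  then have "definable (\<lambda>e. \<exists>x. e 0 = (x + a) mod int k \<and> (\<exists>y. e 1 = (y + b) mod int l \<and>
      (\<exists>z. e 2 = (z + c) mod int m \<and> [x, y, z] \<in> S)))"
    by (intro definable_ex[where j = 3]) simp_all
  moreover have "map e [0..<3] \<in> ?T \<longleftrightarrow> (\<exists>x. e 0 = (x + a) mod int k \<and>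
      (\<exists>y. e 1 = (y + b) mod int l \<and> (\<exists>z. e 2 = (z + c) mod int m \<and> [x, y, z] \<in> S)))" for e
    by (auto simp: upt3)
  ultimately show ?thesis
    by (auto simp: presburger_definable_iff)
qed


section \<open>Actions of the translation group\<close>

lemma integer_action_closed:
  assumes "group_action integer_group X act" "x \<in> X"
  shows "act z x \<in> X"
  using group_action.element_image[OF assms(1) _ assms(2)] by simp

lemma integer_action_0:
  assumes "group_action integer_group X act" "x \<in> X"
  shows "act 0 x = x"
  using group_action.id_eq_one[OF assms(1)] assms(2) by (metis one_integer_group restrict_apply')

lemma integer_action_add:
  assumes "group_action integer_group X act" "x \<in> X"
  shows "act (z + w) x = act z (act w x)"
  using group_action.composition_rule[OF assms] by simp

lemma integer_action_minus:
  assumes "group_action integer_group X act" "x \<in> X"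
  shows "act (- z) (act z x) = x" "act z (act (- z) x) = x"
  using integer_action_add[OF assms, of "- z" z] integer_action_add[OF assms, of z "- z"]
    integer_action_0[OF assms] by simp_all

text \<open>\<open>act (- z)\<close> inverts \<open>act z\<close>, which supplies bijectivity;
  extensionality lets the pointwise addition law become an equation in
  \<open>BijGroup X\<close>.\<close>

lemma group_action_integer_groupI:
  assumes ext: "\<And>z. act z \<in> extensional X"
    and closed: "\<And>z x. x \<in> X \<Longrightarrow> act z x \<in> X"
    and zero: "\<And>x. x \<in> X \<Longrightarrow> act 0 x = x"
    and add: "\<And>z w x. x \<in> X \<Longrightarrow> act (z + w) x = act z (act w x)"
  shows "group_action integer_group X act"
proof -
  have "bij_betw (act z) X X" for z
    by (rule bij_betw_byWitness[where f' = "act (- z)"])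
      (use closed zero add[of _ "- z" z] add[of _ z "- z"] in auto)
  then have Bij: "act z \<in> Bij X" for z
    using ext by (simp add: Bij_def)
  have "act (z + w) = compose X (act z) (act w)" for z w
    using ext add by (intro extensionalityI[of _ X]) (auto simp: compose_def)
  then have "act \<in> hom integer_group (BijGroup X)"
    using Bij by (intro homI) (auto simp: BijGroup_def)
  then show ?thesis
    by (simp add: group_action_def group_hom_def group_hom_axioms_def group_BijGroup)
qed

section \<open>Orbits and their coordinates\<close>

lemma orbit_integer_group: "orbit integer_group act x = range (\<lambda>z. act z x)"
  by (auto simp: orbit_def)

lemma orbit_eq_of_mem:
  assumes "group_action integer_group X act" "x \<in> X" "y \<in> orbit integer_group act x"
  shows "orbit integer_group act y = orbit integer_group act x"
proof -
  obtain w where y: "y = act w x"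
    using assms(3) by (auto simp: orbit_integer_group)
  have "act z y = act (z + w) x" "act z x = act (z - w) y" for z
    using integer_action_add[OF assms(1,2), of z w] integer_action_add[OF assms(1,2), of "z - w" w]
    by (simp_all add: y)
  then show ?thesis
    unfolding orbit_integer_group by (intro subset_antisym image_subsetI) (metis rangeI)+
qed

text \<open>The generator is the least positive element of \<open>H\<close>, or 0 when there is
  none. Applied to the stabilizer of a point, this yields the modulus of its orbit.\<close>

lemma int_subgroup_eq_multiples:
  fixes H :: "int set"
  assumes "0 \<in> H" "\<And>x y. x \<in> H \<Longrightarrow> y \<in> H \<Longrightarrow> x - y \<in> H"
  shows "\<exists>k::nat. \<forall>z. z \<in> H \<longleftrightarrow> int k dvd z"
proof (cases "H \<subseteq> {0}")
  case True
  then show ?thesis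
    using assms(1) by (intro exI[of _ 0]) auto
next
  case False
  have neg: "- x \<in> H" if "x \<in> H" for x
    using assms(2)[OF assms(1) that] by simp
  have add: "x + y \<in> H" if "x \<in> H" "y \<in> H" for x y
    using assms(2)[OF that(1) neg[OF that(2)]] by simp
  define k where "k = (LEAST n. 0 < n \<and> int n \<in> H)"
  obtain z where "z \<in> H" "z \<noteq> 0"
    using False by blast
  then have "0 < nat \<bar>z\<bar> \<and> int (nat \<bar>z\<bar>) \<in> H"
    using neg by (auto simp: abs_if)
  then have "0 < k \<and> int k \<in> H"
    unfolding k_def by (rule LeastI)
  then have k: "0 < k" "int k \<in> H"
    by auto
  have "int n * int k \<in> H" for n
    by (induction n) (auto simp: assms(1) algebra_simps k(2) add)
  then have mult: "c * int k \<in> H" for c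
    using neg by (cases c rule: int_cases2) (metis, metis mult_minus_left)
  have "int k dvd z" if "z \<in> H" for z
  proof -
    \<comment> \<open>The remainder lies in \<open>H\<close> and is smaller than \<open>k\<close>,
      so minimality forces it to be 0.\<close>
    have "z mod int k \<in> H"
      using assms(2)[OF that mult[of "z div int k"]] by (simp add: minus_div_mult_eq_mod)
    moreover have "z mod int k < int k" "0 \<le> z mod int k"
      using k(1) by simp_all
    ultimately have "\<not> 0 < nat (z mod int k)"
      using not_less_Least[of "nat (z mod int k)" "\<lambda>n. 0 < n \<and> int n \<in> H"] unfolding k_def[symmetric]
      by (auto simp: nat_less_iff)
    then show ?thesis
      using \<open>0 \<le> z mod int k\<close> by (simp add: dvd_eq_mod_eq_0)
  qed
  then show ?thesis
    using mult by (intro exI[of _ k]) (auto simp: mult.commute elim!: dvdE)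
qed

text \<open>Orbit-stabilizer: the stabilizer of \<open>x\<close> consists of the multiples of some
  \<open>k\<close>, so sending \<open>act z x\<close> to the residue of \<open>z\<close> is well
  defined, injective and compatible with translations.\<close>

lemma orbit_iso_exists:
  assumes "group_action integer_group X act" "P \<in> orbits integer_group X act"
  shows "\<exists>k f. orbit_iso act P k f"
proof -
  obtain x where x: "x \<in> X" and P: "P = orbit integer_group act x"
    using assms(2) by (auto simp: orbits_def)
  note add = integer_action_add[OF assms(1) x]
  have eq_iff: "act z x = act w x \<longleftrightarrow> act (z - w) x = x" for z w
    using add[of w "z - w"] add[of "- w" z] integer_action_minus(1)[OF assms(1) x, of w]
    by (metis add.commute add_diff_cancel_left' diff_add_cancel uminus_add_conv_diff)
  have "act (z - w) x = x" if "act z x = x" "act w x = x" for z w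
    using that by (simp add: eq_iff[symmetric])
  then obtain k :: nat where k: "\<And>z. act z x = x \<longleftrightarrow> int k dvd z"
    using int_subgroup_eq_multiples[of "{z. act z x = x}"] integer_action_0[OF assms(1) x] by auto
  have eq_mod: "act z x = act w x \<longleftrightarrow> z mod int k = w mod int k" for z w
    by (simp add: eq_iff k mod_eq_dvd_iff)
  \<comment> \<open>The choice of \<open>z\<close> is harmless because all candidates agree modulo
    \<open>k\<close>.\<close>
  define f where "f y = (SOME z. act z x = y) mod int k" for y
  have f: "f (act z x) = z mod int k" for z
    unfolding f_def eq_mod[symmetric] by (rule someI) (rule refl)
  have "inj_on f (orbit integer_group act x)"
    by (auto simp: inj_on_def orbit_integer_group f eq_mod)
  moreover have "f ` orbit integer_group act x = carrier (integer_mod_group k)"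
  proof -
    have "y \<in> range (\<lambda>z. z mod int k)" if "y \<in> carrier (integer_mod_group k)" for y
      using mod_carrier[OF that] by (metis rangeI)
    then show ?thesis
      by (auto simp: orbit_integer_group image_image f)
  qed
  moreover have "f (act z y) = (f y + z) mod int k" if "y \<in> orbit integer_group act x" for y z
    using that by (auto simp: orbit_integer_group f add[symmetric] mod_simps add.commute)
  ultimately show ?thesis
    unfolding orbit_iso_def bij_betw_def P by blast
qed

text \<open>An equivariant map out of a single orbit is determined by the image of one point.\<close>

lemma orbit_iso_equivariant_map:
  assumes f: "orbit_iso actX X k f" and g: "orbit_iso actY Y l g"
    and closed: "\<And>x z. x \<in> X \<Longrightarrow> actX z x \<in> X"
    and h: "\<And>x. x \<in> X \<Longrightarrow> h x \<in> Y"
    and equiv: "\<And>x z. x \<in> X \<Longrightarrow> h (actX z x) = actY z (h x)"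
  shows "\<exists>c. \<forall>x\<in>X. g (h x) = (f x + c) mod int l"
proof -
  have bij: "bij_betw f X (carrier (integer_mod_group k))"
    and act: "\<And>x z. x \<in> X \<Longrightarrow> f (actX z x) = (f x + z) mod int k"
    using f by (auto simp: orbit_iso_def)
  obtain x0 where x0: "x0 \<in> X"
    using bij_betw_imp_surj_on[OF bij] integer_mod_group_0[of k] by blast
  have "g (h x) = (f x + (g (h x0) - f x0)) mod int l" if x: "x \<in> X" for x
  proof -
    \<comment> \<open>By injectivity of \<open>f\<close>, this exhibits \<open>x\<close> as the
      translate of the base point by the difference of their coordinates.\<close>
    have "f (actX (f x - f x0) x0) = f x"
      using act[OF x0] bij_betwE[OF bij] x by (simp add: mod_carrier)
    then have "x = actX (f x - f x0) x0"
      using bij_betw_imp_inj_on[OF bij] closed[OF x0] x by (metis inj_onD)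
    then have "g (h x) = g (actY (f x - f x0) (h x0))"
      using equiv[OF x0] by metis
    then show ?thesis
      using g h[OF x0] by (simp add: orbit_iso_def algebra_simps)
  qed
  then show ?thesis
    by blast
qed

text \<open>The coordinates of the pieces \<open>S i\<close> may differ from the prescribed ones,
  but \<open>\<phi>\<close>, \<open>\<psi>\<close> and the change of coordinates on \<open>Y\<close>
  all become shifts followed by a reduction. The orbit \<open>Z i\<close> varies because several
  orbits may be mapped to the same \<open>Z'\<close>.\<close>

lemma semilinear_monomial3_UN_image:
  assumes "finite I"
    and S: "\<And>i. i \<in> I \<Longrightarrow> semilinear_monomial3 actX X actY Y actZ (Z i) (S i)"
    and X: "\<And>x z. x \<in> X \<Longrightarrow> actX z x \<in> X" and Y: "\<And>y z. y \<in> Y \<Longrightarrow> actY z y \<in> Y"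
    and Z: "\<And>i x z. i \<in> I \<Longrightarrow> x \<in> Z i \<Longrightarrow> actZ z x \<in> Z i"
    and iso: "orbit_iso actX' X' k f" "orbit_iso actY Y l g" "orbit_iso actZ' Z' m h"
    and \<phi>: "\<And>x. x \<in> X \<Longrightarrow> \<phi> x \<in> X'" "\<And>x z. x \<in> X \<Longrightarrow> \<phi> (actX z x) = actX' z (\<phi> x)"
    and \<psi>: "\<And>i x. i \<in> I \<Longrightarrow> x \<in> Z i \<Longrightarrow> \<psi> x \<in> Z'"
      "\<And>i x z. i \<in> I \<Longrightarrow> x \<in> Z i \<Longrightarrow> \<psi> (actZ z x) = actZ' z (\<psi> x)"
  shows "semilinear_monomial3 actX' X' actY Y actZ' Z'
    (\<Union>i\<in>I. (\<lambda>(x, y, z). (\<phi> x, y, \<psi> z)) ` S i)"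
proof -
  let ?co = "\<lambda>(x, y, z). [f x, g y, h z]" and ?im = "\<lambda>(x, y, z). (\<phi> x, y, \<psi> z)"
  have sub: "S i \<subseteq> X \<times> Y \<times> Z i" if "i \<in> I" for i
    using S[OF that] by (simp add: semilinear_monomial3_def)
  have "presburger_definable 3 (?co ` ?im ` S i)" if i: "i \<in> I" for i
  proof -
    obtain k' l' m' f' g' h'
      where iso': "orbit_iso actX X k' f'" "orbit_iso actY Y l' g'" "orbit_iso actZ (Z i) m' h'"
        and "semilinear [k', l', m'] ((\<lambda>(x, y, z). [f' x, g' y, h' z]) ` S i)"
      using S[OF i] unfolding semilinear_monomial3_def by blast
    then have def': "presburger_definable 3 ((\<lambda>(x, y, z). [f' x, g' y, h' z]) ` S i)"
      by (simp add: semilinear_iff_presburger_definable numeral_3_eq_3)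
    have "\<exists>a. \<forall>x\<in>X. f (\<phi> x) = (f' x + a) mod int k"
      by (rule orbit_iso_equivariant_map[OF iso'(1) iso(1)]) (simp_all add: X \<phi>)
    then obtain a where a: "\<forall>x\<in>X. f (\<phi> x) = (f' x + a) mod int k" ..
    \<comment> \<open>Two coordinate systems on \<open>Y\<close> are compared by treating the
      identity as an equivariant map.\<close>
    have "\<exists>b. \<forall>y\<in>Y. g y = (g' y + b) mod int l"
      by (rule orbit_iso_equivariant_map[OF iso'(2) iso(2)]) (simp_all add: Y)
    then obtain b where b: "\<forall>y\<in>Y. g y = (g' y + b) mod int l" ..
    have "\<exists>c. \<forall>z\<in>Z i. h (\<psi> z) = (h' z + c) mod int m"
      by (rule orbit_iso_equivariant_map[OF iso'(3) iso(3)]) (simp_all add: Z[OF i] \<psi>[OF i])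
    then obtain c where c: "\<forall>z\<in>Z i. h (\<psi> z) = (h' z + c) mod int m" ..
    have "?co ` ?im ` S i = {[(x + a) mod int k, (y + b) mod int l, (z + c) mod int m] | x y z.
        [x, y, z] \<in> (\<lambda>(x, y, z). [f' x, g' y, h' z]) ` S i}" (is "?A = ?B")
    proof
      show "?A \<subseteq> ?B"
      proof
        fix t assume "t \<in> ?A"
        then obtain x y z where xyz: "(x, y, z) \<in> S i" "t = [f (\<phi> x), g y, h (\<psi> z)]"
          by auto
        then have "t = [(f' x + a) mod int k, (g' y + b) mod int l, (h' z + c) mod int m]"
          using sub[OF i] a b c by auto
        moreover have "[f' x, g' y, h' z] \<in> (\<lambda>(x, y, z). [f' x, g' y, h' z]) ` S i"
          using xyz(1) by force
        ultimately show "t \<in> ?B"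
          by blast
      qed
      show "?B \<subseteq> ?A"
      proof
        fix t assume "t \<in> ?B"
        then obtain x y z where xyz: "(x, y, z) \<in> S i"
            "t = [(f' x + a) mod int k, (g' y + b) mod int l, (h' z + c) mod int m]"
          by auto
        then have "t = ?co (?im (x, y, z))"
          using sub[OF i] a b c by auto
        then show "t \<in> ?A"
          using xyz(1) by blast
      qed
    qed
    then show ?thesis
      using presburger_definable_image_mod3[OF def'] by simp
  qed
  then have "presburger_definable 3 (?co ` (\<Union>i\<in>I. ?im ` S i))"
    using presburger_definable_UN[OF assms(1)] by (simp add: image_UN)
  moreover have subT: "(\<Union>i\<in>I. ?im ` S i) \<subseteq> X' \<times> Y \<times> Z'"
    using sub \<phi>(1) \<psi>(1) by fastforce
  moreover have "?co ` (\<Union>i\<in>I. ?im ` S i) \<subseteq> monomial [k, l, m]"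
  proof -
    have "?co ` (X' \<times> Y \<times> Z') \<subseteq> monomial [k, l, m]"
      using iso by (auto simp: orbit_iso_def dest!: bij_betwE)
    then show ?thesis
      using subT by blast
  qed
  ultimately show ?thesis
    using iso unfolding semilinear_monomial3_def
    by (intro conjI exI[of _ k] exI[of _ l] exI[of _ m] exI[of _ f] exI[of _ g] exI[of _ h])
      (simp_all add: semilinear_iff_presburger_definable numeral_3_eq_3)
qed

section \<open>The minimal automaton as a quotient of the reachable part\<close>

locale equivariant_automaton =
  fixes M :: "('a, 'q) automaton"
  assumes dfa: "dfa M" and equivariant: "equivariant_dfa M"
begin

abbreviation "A \<equiv> alphabet M"
abbreviation "act \<equiv> letter_act M"
abbreviation "Q \<equiv> states M"
abbreviation "sact \<equiv> state_act M"
abbreviation "run \<equiv> foldl (trans M)"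
abbreviation "L \<equiv> language M"
abbreviation "MN \<equiv> myhill_nerode A L"
abbreviation "Mmin \<equiv> minimal_automaton A act L"

text \<open>States of the minimal automaton are classes of words, so only reachable states represent
  them; an unreachable state may have an empty \<open>residual_class\<close>.\<close>

definition reachable :: "'q set" where
  "reachable = run (initial M) ` lists A"

text \<open>For \<open>q\<close> reached by a word \<open>u\<close> this is the class of \<open>u\<close>; defining it through the language
  accepted from \<open>q\<close> makes independence of \<open>u\<close> automatic.\<close>

definition residual_class :: "'q \<Rightarrow> 'a list set" where
  "residual_class q = {v \<in> lists A. \<forall>w\<in>lists A. v @ w \<in> L \<longleftrightarrow> run q w \<in> accepting M}"

section \<open>Equivariance of runs and of the language\<close>

lemma letter_action: "group_action integer_group A act"
  and state_action: "group_action integer_group Q sact"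
  using dfa by (simp_all add: dfa_def orbit_finite_def)

lemmas act_closed = integer_action_closed[OF letter_action]
  and act_minus = integer_action_minus[OF letter_action]
  and sact_closed = integer_action_closed[OF state_action]
  and sact_minus = integer_action_minus[OF state_action]

lemma initial_mem: "initial M \<in> Q"
  and trans_mem: "q \<in> Q \<Longrightarrow> a \<in> A \<Longrightarrow> trans M q a \<in> Q"
  and accepting_subset: "accepting M \<subseteq> Q"
  using dfa by (auto simp: dfa_def)

lemma sact_initial: "sact z (initial M) = initial M"
  and trans_act: "q \<in> Q \<Longrightarrow> a \<in> A \<Longrightarrow> trans M (sact z q) (act z a) = sact z (trans M q a)"
  using equivariant by (auto simp: equivariant_dfa_def)

lemma sact_accepting_iff:
  assumes "q \<in> Q"
  shows "sact z q \<in> accepting M \<longleftrightarrow> q \<in> accepting M"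
proof -
  have "sact z ` accepting M = accepting M" for z
    using equivariant by (auto simp: equivariant_dfa_def equivariant_set_def)
  then show ?thesis
    using sact_minus(1)[OF assms, of z] by (metis imageI)
qed

lemma run_mem: "q \<in> Q \<Longrightarrow> w \<in> lists A \<Longrightarrow> run q w \<in> Q"
  by (induction w arbitrary: q) (auto simp: trans_mem)

lemma run_act:
  "q \<in> Q \<Longrightarrow> w \<in> lists A \<Longrightarrow> run (sact z q) (map (act z) w) = sact z (run q w)"
  by (induction w arbitrary: q) (auto simp: trans_mem trans_act)

lemma map_act_mem: "w \<in> lists A \<Longrightarrow> map (act z) w \<in> lists A"
  by (auto simp: act_closed)

lemma map_act_minus: "w \<in> lists A \<Longrightarrow> map (act z) (map (act (- z)) w) = w"
  by (induction w) (auto simp: act_minus)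

lemma language_append_iff:
  "u \<in> lists A \<Longrightarrow> w \<in> lists A \<Longrightarrow> u @ w \<in> L \<longleftrightarrow> run (run (initial M) u) w \<in> accepting M"
  by (auto simp: language_def)

text \<open>The initial state is fixed, so translating a word translates the state it reaches, and
  acceptance is invariant.\<close>

lemma map_act_language_iff:
  assumes "w \<in> lists A"
  shows "map (act z) w \<in> L \<longleftrightarrow> w \<in> L"
  using run_act[OF initial_mem assms, of z] run_mem[OF initial_mem assms] map_act_mem[OF assms, of z]
    assms
  by (simp add: language_def sact_initial sact_accepting_iff)

text \<open>Acceptance of \<open>u @ w\<close> is decided by the state reached after
  \<open>u\<close>, so comparing \<open>v\<close> with this state amounts to comparing
  \<open>v\<close> with \<open>u\<close>.\<close>

lemma residual_class_run:
  assumes "u \<in> lists A"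
  shows "residual_class (run (initial M) u) = MN `` {u}"
  using assms unfolding residual_class_def myhill_nerode_def
  by (auto simp: language_append_iff)

text \<open>One inclusion is proved for all \<open>z\<close> and \<open>q\<close>; applied to
  \<open>- z\<close> and \<open>sact z q\<close> it gives the other.\<close>

lemma residual_class_act:
  assumes "q \<in> Q"
  shows "residual_class (sact z q) = map (act z) ` residual_class q"
proof
  have sub: "map (act z) ` residual_class q \<subseteq> residual_class (sact z q)" if q: "q \<in> Q" for z q
  proof (rule image_subsetI)
    fix v assume v: "v \<in> residual_class q"
    then have vA: "v \<in> lists A"
      by (simp add: residual_class_def)
    have "map (act z) v @ w \<in> L \<longleftrightarrow> run (sact z q) w \<in> accepting M" if w: "w \<in> lists A" for w
    proof -
      \<comment> \<open>Moving the suffix back lets the whole word \<open>v @ ?w\<close> be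
        translated at once.\<close>
      let ?w = "map (act (- z)) w"
      have w': "?w \<in> lists A" "map (act z) ?w = w"
        using map_act_mem map_act_minus w by blast+
      have "map (act z) v @ w \<in> L \<longleftrightarrow> map (act z) (v @ ?w) \<in> L"
        using w'(2) by simp
      also have "\<dots> \<longleftrightarrow> v @ ?w \<in> L"
        using vA w'(1) by (intro map_act_language_iff) auto
      also have "\<dots> \<longleftrightarrow> run q ?w \<in> accepting M"
        using v w'(1) by (simp add: residual_class_def)
      also have "\<dots> \<longleftrightarrow> run (sact z q) w \<in> accepting M"
        using run_act[OF q w'(1), of z] sact_accepting_iff[OF run_mem[OF q w'(1)], of z]
        unfolding w'(2) by simp
      finally show ?thesis .
    qed
    then show "map (act z) v \<in> residual_class (sact z q)"
      using map_act_mem[OF vA] by (simp add: residual_class_def)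
  qed
  show "map (act z) ` residual_class q \<subseteq> residual_class (sact z q)"
    using sub[OF assms] .
  show "residual_class (sact z q) \<subseteq> map (act z) ` residual_class q"
  proof
    fix v assume v: "v \<in> residual_class (sact z q)"
    then have "map (act (- z)) v \<in> residual_class q"
      using sub[OF sact_closed[OF assms], of "- z" z] sact_minus(1)[OF assms] by auto
    then show "v \<in> map (act z) ` residual_class q"
      using map_act_minus[of v z] v by (metis (no_types, lifting) image_eqI mem_Collect_eq residual_class_def)
  qed
qed

section \<open>Reachable states\<close>

lemma initial_reachable: "initial M \<in> reachable"
  unfolding reachable_def by (rule image_eqI[of _ _ "[]"]) auto

lemma reachable_mem: "q \<in> reachable \<Longrightarrow> q \<in> Q"
  using run_mem[OF initial_mem] by (auto simp: reachable_def)

lemma trans_reachable: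
  assumes "q \<in> reachable" "a \<in> A"
  shows "trans M q a \<in> reachable"
proof -
  obtain u where "u \<in> lists A" "q = run (initial M) u"
    using assms(1) by (auto simp: reachable_def)
  then show ?thesis
    unfolding reachable_def using assms(2) by (intro image_eqI[of _ _ "u @ [a]"]) auto
qed

lemma sact_reachable:
  assumes "q \<in> reachable"
  shows "sact z q \<in> reachable"
proof -
  obtain u where "u \<in> lists A" "q = run (initial M) u"
    using assms by (auto simp: reachable_def)
  then show ?thesis
    unfolding reachable_def using run_act[OF initial_mem, of u z] map_act_mem[of u z]
    by (intro image_eqI[of _ _ "map (act z) u"]) (simp_all add: sact_initial)
qed

section \<open>The minimal automaton in terms of residual classes\<close>

lemma minimal_automaton_simps [simp]:
  "alphabet Mmin = A" "letter_act Mmin = act"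
  by (simp_all add: minimal_automaton_def)

lemma equiv_myhill_nerode: "equiv (lists A) MN"
  by (auto simp: myhill_nerode_def intro!: equivI refl_onI symI transI)

lemma states_minimal: "states Mmin = residual_class ` reachable"
proof -
  have "residual_class ` reachable = (\<lambda>u. MN `` {u}) ` lists A"
    unfolding reachable_def image_image using residual_class_run by (rule image_cong[OF refl])
  then show ?thesis
    by (auto simp: minimal_automaton_def quotient_def)
qed

lemma state_act_minimal:
  "q \<in> reachable \<Longrightarrow> state_act Mmin z (residual_class q) = residual_class (sact z q)"
  using states_minimal by (simp add: minimal_automaton_def residual_class_act reachable_mem)

lemma initial_minimal: "initial Mmin = residual_class (initial M)"
  using residual_class_run[of "[]"] by (simp add: minimal_automaton_def)

text \<open>The accepting reachable states are those reached by words of \<open>L\<close>.\<close>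

lemma accepting_minimal: "accepting Mmin = residual_class ` (accepting M \<inter> reachable)"
proof -
  have "accepting M \<inter> reachable = run (initial M) ` L"
    by (auto simp: reachable_def language_def)
  moreover have "residual_class ` run (initial M) ` L = (\<lambda>w. MN `` {w}) ` L"
    unfolding image_image
    by (rule image_cong[OF refl], rule residual_class_run) (simp add: language_def)
  ultimately show ?thesis
    by (auto simp: minimal_automaton_def)
qed

text \<open>The Myhill-Nerode equivalence is a right congruence, so all members of the union
  defining \<open>trans\<close> coincide.\<close>

lemma trans_minimal:
  assumes "q \<in> reachable" "a \<in> A"
  shows "trans Mmin (residual_class q) a = residual_class (trans M q a)"
proof -
  obtain u where u: "u \<in> lists A" "q = run (initial M) u"
    using assms(1) by (auto simp: reachable_def)
  have "MN `` {w @ [a]} = MN `` {u @ [a]}" if "w \<in> MN `` {u}" for w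
  proof (rule equiv_class_eq[OF equiv_myhill_nerode])
    have "w \<in> lists A" "\<And>v. v \<in> lists A \<Longrightarrow> u @ v \<in> L \<longleftrightarrow> w @ v \<in> L"
      using that by (auto simp: myhill_nerode_def)
    moreover have "a # v \<in> lists A" if "v \<in> lists A" for v
      using that assms(2) by simp
    ultimately show "(w @ [a], u @ [a]) \<in> MN"
      using u(1) assms(2) by (auto simp: myhill_nerode_def)
  qed
  moreover have "u \<in> MN `` {u}"
    using u(1) by (auto simp: myhill_nerode_def)
  ultimately have "(\<Union>w\<in>MN `` {u}. MN `` {w @ [a]}) = MN `` {u @ [a]}"
    by blast
  moreover have "u @ [a] \<in> lists A"
    using u(1) assms(2) by simp
  ultimately show ?thesis
    using residual_class_run[of "u @ [a]"] residual_class_run[OF u(1)]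
    by (simp add: minimal_automaton_def u(2))
qed

text \<open>The laws are checked on reachable representatives, where they descend from the action on
  \<open>Q\<close>.\<close>

lemma state_action_minimal: "group_action integer_group (states Mmin) (state_act Mmin)"
proof (rule group_action_integer_groupI)
  show "state_act Mmin z \<in> extensional (states Mmin)" for z
    by (simp add: minimal_automaton_def)
  fix C assume "C \<in> states Mmin"
  then obtain q where q: "C = residual_class q" "q \<in> reachable"
    by (auto simp: states_minimal)
  show "state_act Mmin z C \<in> states Mmin" for z
    using q by (simp add: states_minimal state_act_minimal sact_reachable)
  show "state_act Mmin 0 C = C"
    using q integer_action_0[OF state_action] by (simp add: state_act_minimal reachable_mem)
  show "state_act Mmin (z + w) C = state_act Mmin z (state_act Mmin w C)" for z w
    using q integer_action_add[OF state_action]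
    by (simp add: state_act_minimal reachable_mem sact_reachable)
qed

section \<open>Orbit-finiteness, equivariance and semilinearity of the minimal automaton\<close>

lemma orbit_minimal:
  assumes "q \<in> reachable"
  shows "orbit integer_group (state_act Mmin) (residual_class q) =
    residual_class ` orbit integer_group sact q"
  using assms by (simp add: orbit_integer_group image_image state_act_minimal)

lemma orbit_subset_reachable:
  "q \<in> reachable \<Longrightarrow> orbit integer_group sact q \<subseteq> reachable"
  by (auto simp: orbit_integer_group sact_reachable)

lemma orbits_minimalE:
  assumes "P \<in> orbits integer_group (states Mmin) (state_act Mmin)"
  obtains q where "q \<in> reachable" "P = residual_class ` orbit integer_group sact q"
  using assms that by (auto simp: orbits_def states_minimal orbit_minimal)

text \<open>Orbits of classes are images of orbits of states, of which there are finitely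
  many.\<close>

lemma dfa_minimal: "dfa Mmin"
proof -
  have "orbits integer_group (states Mmin) (state_act Mmin) \<subseteq>
      (`) residual_class ` orbits integer_group Q sact"
    using reachable_mem by (fastforce simp: orbits_def[of _ Q] elim!: orbits_minimalE)
  moreover have "finite (orbits integer_group Q sact)"
    using dfa by (simp add: dfa_def orbit_finite_def)
  ultimately have "orbit_finite (states Mmin) (state_act Mmin)"
    unfolding orbit_finite_def using state_action_minimal by (metis finite_imageI finite_subset)
  moreover have "orbit_finite A act"
    using dfa by (simp add: dfa_def)
  moreover have "trans Mmin C a \<in> states Mmin" if "C \<in> states Mmin" "a \<in> A" for C a
    using that by (auto simp: states_minimal trans_minimal trans_reachable)
  ultimately show ?thesis
    unfolding dfa_def
    by (auto simp: states_minimal initial_minimal initial_reachable accepting_minimal)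
qed

lemma equivariant_dfa_minimal: "equivariant_dfa Mmin"
proof -
  have sub: "state_act Mmin z ` accepting Mmin \<subseteq> accepting Mmin" for z
    using accepting_subset
    by (auto simp: accepting_minimal state_act_minimal sact_reachable sact_accepting_iff reachable_mem)
  have "accepting Mmin \<subseteq> state_act Mmin z ` accepting Mmin" for z
  proof
    fix C assume C: "C \<in> accepting Mmin"
    then have "C \<in> states Mmin"
      by (auto simp: accepting_minimal states_minimal)
    \<comment> \<open>Writing \<open>C\<close> as a translate of its back-translate reduces this
      inclusion to \<open>sub\<close> for \<open>- z\<close>.\<close>
    then have "C = state_act Mmin z (state_act Mmin (- z) C)"
      using integer_action_minus(2)[OF state_action_minimal] by simp
    then show "C \<in> state_act Mmin z ` accepting Mmin"
      using sub[of "- z"] C by blast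
  qed
  then have "equivariant_set (state_act Mmin) (accepting Mmin)"
    unfolding equivariant_set_def using sub by blast
  moreover have "trans Mmin (state_act Mmin z C) (act z a) = state_act Mmin z (trans Mmin C a)"
    if "C \<in> states Mmin" "a \<in> A" for C a z
    using that by (auto simp: states_minimal state_act_minimal trans_minimal trans_reachable
        sact_reachable act_closed trans_act reachable_mem)
  ultimately show ?thesis
    unfolding equivariant_dfa_def
    by (auto simp: initial_minimal state_act_minimal initial_reachable sact_initial)
qed

text \<open>
  Over a product of orbits of the minimal automaton, the transition graph is a finite union of
  images of pieces of the original graph: one fixed orbit above the source suffices, but all orbits
  above the target are needed.
\<close>

lemma semilinear_dfa_minimal:
  assumes "semilinear_dfa M"
  shows "semilinear_dfa Mmin"
proof -
  have graph: "trans_graph Mmin \<subseteq> states Mmin \<times> A \<times> states Mmin"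
    using dfa_minimal by (auto simp: trans_graph_def dfa_def)
  have "semilinear_monomial3 (state_act Mmin) P act B (state_act Mmin) R (trans_graph Mmin \<inter> P \<times> B \<times> R)"
    if P: "P \<in> orbits integer_group (states Mmin) (state_act Mmin)"
      and B: "B \<in> orbits integer_group A act"
      and R: "R \<in> orbits integer_group (states Mmin) (state_act Mmin)" for P B R
  proof -
    obtain q where q: "q \<in> reachable" "P = residual_class ` orbit integer_group sact q"
      using orbits_minimalE[OF P] .
    \<comment> \<open>Any reachable orbit above \<open>P\<close> will do:
      \<open>trans_minimal\<close> computes a transition from any reachable representative of its
      source, and \<open>P'\<close> contains one for every class in \<open>P\<close>.\<close>
    define P' where "P' = orbit integer_group sact q"
    have P': "P = residual_class ` P'" "P' \<subseteq> reachable" "P' \<in> orbits integer_group Q sact"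
      using q orbit_subset_reachable reachable_mem by (auto simp: P'_def orbits_def)
    obtain b where b: "b \<in> A" "B = orbit integer_group act b"
      using B by (auto simp: orbits_def)
    \<comment> \<open>Transitions from \<open>P'\<close> into classes of \<open>R\<close> may end in
      different orbits above \<open>R\<close>, so all of these are collected.\<close>
    define I where "I = {R' \<in> orbits integer_group Q sact. R' \<subseteq> reachable \<and> residual_class ` R' = R}"
    have "finite I"
      using dfa by (simp add: I_def dfa_def orbit_finite_def)
    have closed: "sact z x \<in> O'" if "O' \<in> orbits integer_group Q sact" "x \<in> O'" for O' x z
      using that integer_action_add[OF state_action, symmetric]
      by (auto simp: orbits_def orbit_integer_group)
    obtain k f where f: "orbit_iso (state_act Mmin) P k f"
      using orbit_iso_exists[OF state_action_minimal P] by blast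
    obtain l g where g: "orbit_iso act B l g"
      using orbit_iso_exists[OF letter_action B] by blast
    obtain m h where h: "orbit_iso (state_act Mmin) R m h"
      using orbit_iso_exists[OF state_action_minimal R] by blast
    have "semilinear_monomial3 (state_act Mmin) P act B (state_act Mmin) R
        (\<Union>R'\<in>I. (\<lambda>(x, y, z). (residual_class x, y, residual_class z)) `
          (trans_graph M \<inter> P' \<times> B \<times> R'))"
    proof (rule semilinear_monomial3_UN_image[where actX = sact and X = P' and Z = "\<lambda>R. R" and actZ = sact,
          OF \<open>finite I\<close> _ _ _ _ f g h])
      fix R' assume "R' \<in> I"
      then show "semilinear_monomial3 sact P' act B sact R' (trans_graph M \<inter> P' \<times> B \<times> R')"
        using assms P'(3) B unfolding semilinear_dfa_def semilinear_polynomial3_def I_def by blast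
    next
      fix y z assume "y \<in> B"
      then show "act z y \<in> B"
        using integer_action_add[OF letter_action b(1), symmetric] by (auto simp: b(2) orbit_integer_group)
    qed (use P' closed state_act_minimal in \<open>auto simp: I_def subset_eq\<close>)
    moreover have "trans_graph Mmin \<inter> P \<times> B \<times> R =
        (\<Union>R'\<in>I. (\<lambda>(x, y, z). (residual_class x, y, residual_class z)) `
          (trans_graph M \<inter> P' \<times> B \<times> R'))" (is "?G = ?U")
    proof
      show "?G \<subseteq> ?U"
      proof
        fix t assume t: "t \<in> ?G"
        then obtain C a where C: "t = (C, a, trans Mmin C a)" "C \<in> P" "a \<in> A" "a \<in> B"
            "trans Mmin C a \<in> R"
          by (auto simp: trans_graph_def)
        obtain x where x: "x \<in> P'" "C = residual_class x"
          using C(2) P'(1) by blast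
        have xr: "x \<in> reachable"
          using x(1) P'(2) by blast
        define y where "y = trans M x a"
        have y: "y \<in> reachable" "trans Mmin C a = residual_class y"
          using xr C(3) x(2) by (simp_all add: y_def trans_reachable trans_minimal)
        obtain D where D: "D \<in> states Mmin" "R = orbit integer_group (state_act Mmin) D"
          using R by (auto simp: orbits_def)
        \<comment> \<open>The orbit of \<open>y\<close> is mapped onto the orbit of its class, which
          is \<open>R\<close> because that class lies in \<open>R\<close>.\<close>
        have "residual_class ` orbit integer_group sact y = R"
          using orbit_eq_of_mem[OF state_action_minimal D(1), of "residual_class y"] C(5) D(2)
          by (simp add: orbit_minimal[OF y(1), symmetric] y(2))
        then have "orbit integer_group sact y \<in> I"
          using y(1) orbit_subset_reachable reachable_mem by (auto simp: I_def orbits_def)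
        moreover have "y \<in> orbit integer_group sact y"
          using group_action.orbit_refl[OF state_action] reachable_mem[OF y(1)] by blast
        moreover have "(x, a, y) \<in> trans_graph M"
          using xr C(3) reachable_mem by (auto simp: trans_graph_def y_def)
        ultimately show "t \<in> ?U"
          using C(1,4) x y(2) by (intro UN_I image_eqI[of _ _ "(x, a, y)"]) auto
      qed
      show "?U \<subseteq> ?G"
      proof
        fix t assume "t \<in> ?U"
        then obtain R' x a where t: "R' \<in> I" "x \<in> P'" "a \<in> A" "a \<in> B" "trans M x a \<in> R'"
            "t = (residual_class x, a, residual_class (trans M x a))"
          by (auto simp: trans_graph_def)
        have x: "x \<in> reachable"
          using t(2) P'(2) by blast
        then have "t \<in> trans_graph Mmin"
          using t(3,6) trans_minimal[OF x t(3)] by (auto simp: trans_graph_def states_minimal)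
        then show "t \<in> ?G"
          using t P'(1) by (auto simp: I_def)
      qed
    qed
    ultimately show ?thesis
      by simp
  qed
  then show ?thesis
    using graph by (simp add: semilinear_dfa_def semilinear_polynomial3_def)
qed

end

theorem theorem4:
  fixes A :: "'a set" and act :: "int \<Rightarrow> 'a \<Rightarrow> 'a" and L :: "'a list set"
    and M :: "('a, 'q) automaton"
  assumes "dfa M" and "equivariant_dfa M" and "semilinear_dfa M"
    and "alphabet M = A" and "letter_act M = act" and "language M = L"
  shows "dfa (minimal_automaton A act L) \<and>
         equivariant_dfa (minimal_automaton A act L) \<and>
         semilinear_dfa (minimal_automaton A act L)"
proof -
  interpret equivariant_automaton M
    using assms(1,2) by unfold_locales
  show ?thesis
    using dfa_minimal equivariant_dfa_minimal semilinear_dfa_minimal assms by simp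
qed

end
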